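(* Let $r\ge1$ be a fixed integer. For all $Y\in\mathbb{R}^{n\times p}$ of full column rank, the order-$r$ Newton--Schulz update $$N_r(Y)=Y\big(q_r(Y^\top Y-I_p)-I_p\big),\qquad q_r(S)=\sum_{j=0}^{r}(-1)^j\frac{(2j)!}{(j!)^2}\frac{S^j}{4^j},$$ lies in the normal space at $Y$ of the layered manifold $\mathrm{St}_{Y^\top Y}(p,n)$ with respect to the metric $g$, i.e. $$N_r(Y)\in\mathrm{N}_Y\mathrm{St}_{Y^\top Y}(p,n).$$
   Context: For $Y\in\mathbb{R}^{n\times p}$ of full column rank ($p\le n$), the layered manifold is $\mathrm{St}_{Y^\top Y}(p,n)=\{Z\in\mathbb{R}^{n\times p}:Z^\top Z=Y^\top Y\}$. The set of full-column-rank $n\times p$ matrices carries the Riemannian metric $g_Y(\xi,\eta)=\mathrm{tr}\big(\xi^\top(I_n-\tfrac12Y(Y^\top Y)^{-1}Y^\top)\eta(Y^\top Y)^{-1}\big)$, and the normal space of $\mathrm{St}_{Y^\top Y}(p,n)$ at $Y$ with respect to $g$ is $$\mathrm{N}_Y\mathrm{St}_{Y^\top Y}(p,n)=\{Y(Y^\top Y)^{-1}S: S\in\mathbb{R}^{p\times p},\ S=S^\top\}.$$ *)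

theory Defs
  imports "HOL-Analysis.Analysis"
begin

definition layered_manifold :: "real^'p^'n \<Rightarrow> (real^'p^'n) set" where
  "layered_manifold Y = {Z. transpose Z ** Z = transpose Y ** Y}"

definition layered_metric :: "real^'p^'n \<Rightarrow> real^'p^'n \<Rightarrow> real^'p^'n \<Rightarrow> real" where
  "layered_metric Y \<xi> \<eta> =
     trace (transpose \<xi>
       ** (mat 1 - (1/2) *\<^sub>R (Y ** matrix_inv (transpose Y ** Y) ** transpose Y))
       ** \<eta> ** matrix_inv (transpose Y ** Y))"

(* Velocities at x of curves in M. Only differentiability at the base point is required of the
   curves; for an embedded submanifold these are the same vectors as those of smooth curves. *)
definition tangent_vectors :: "'a::real_normed_vector set \<Rightarrow> 'a \<Rightarrow> 'a set" where
  "tangent_vectors M x =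
     {\<xi>. \<exists>\<gamma> :: real \<Rightarrow> 'a. \<gamma> 0 = x \<and> (\<forall>\<^sub>F t in nhds 0. \<gamma> t \<in> M)
            \<and> (\<gamma> has_vector_derivative \<xi>) (at 0)}"

definition normal_vectors ::
  "('a \<Rightarrow> 'a \<Rightarrow> 'a \<Rightarrow> real) \<Rightarrow> 'a::real_normed_vector set \<Rightarrow> 'a \<Rightarrow> 'a set" where
  "normal_vectors g M x = {\<eta>. \<forall>\<xi>\<in>tangent_vectors M x. g x \<xi> \<eta> = 0}"

definition layered_normal_space :: "real^'p^'n \<Rightarrow> (real^'p^'n) set" where
  "layered_normal_space Y = normal_vectors layered_metric (layered_manifold Y) Y"

(* The class power A ^ k on real^'p^'p is the entrywise one, hence a separate matrix power. *)
primrec matrix_power :: "real^'p^'p \<Rightarrow> nat \<Rightarrow> real^'p^'p" where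
  "matrix_power A 0 = mat 1"
| "matrix_power A (Suc k) = matrix_power A k ** A"

definition newton_schulz_poly :: "nat \<Rightarrow> real^'p^'p \<Rightarrow> real^'p^'p" where
  "newton_schulz_poly r S =
     (\<Sum>j=0..r. ((-1) ^ j * (fact (2 * j) / (fact j)\<^sup>2) / 4 ^ j) *\<^sub>R matrix_power S j)"

definition newton_schulz_update :: "nat \<Rightarrow> real^'p^'n \<Rightarrow> real^'p^'n" where
  "newton_schulz_update r Y =
     Y ** (newton_schulz_poly r (transpose Y ** Y - mat 1) - mat 1)"

lemma gram_inverse:
  fixes Y :: "real^'p^'n"
  assumes "rank Y = CARD('p)"
  shows "(transpose Y ** Y) ** matrix_inv (transpose Y ** Y) = mat 1"
    and "matrix_inv (transpose Y ** Y) ** (transpose Y ** Y) = mat 1"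
    and "transpose (matrix_inv (transpose Y ** Y)) = matrix_inv (transpose Y ** Y)"
proof -
  let ?G = "transpose Y ** Y"
  have inj: "inj ((*v) Y)"
    using assms full_rank_injective by blast
  have "x = 0" if "?G *v x = 0" for x
  proof -
    have "(Y *v x) \<bullet> (Y *v x) = x \<bullet> (?G *v x)"
      by (metis dot_lmul_matrix inner_commute matrix_vector_mul_assoc transpose_matrix_vector)
    with that have "Y *v x = Y *v 0" by simp
    with inj show "x = 0" by (meson injD)
  qed
  then have "\<exists>B. B ** ?G = mat 1"
    by (simp add: matrix_left_invertible_ker)
  then have "invertible ?G"
    by (simp add: invertible_left_inverse)
  then have "?G ** matrix_inv ?G = mat 1 \<and> matrix_inv ?G ** ?G = mat 1"
    unfolding invertible_def matrix_inv_def by (rule someI_ex)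
  then show 1: "?G ** matrix_inv ?G = mat 1" and 2: "matrix_inv ?G ** ?G = mat 1"
    by blast+
  let ?T = "transpose (matrix_inv ?G)"
  have "?T ** ?G = transpose (?G ** matrix_inv ?G)"
    by (simp add: matrix_transpose_mul)
  then have "?T ** ?G = mat 1" by (simp add: 1)
  then have "?T ** (?G ** matrix_inv ?G) = matrix_inv ?G"
    by (simp add: matrix_mul_assoc)
  then show "?T = matrix_inv ?G" by (simp only: 1 matrix_mul_rid)
qed

lemma matrix_diff_distribs:
  fixes A B :: "real^'b^'a" and C D :: "real^'c^'b"
  shows "(A - B) ** C = A ** C - B ** C" and "A ** (C - D) = A ** C - A ** D"
  by (simp_all add: matrix_matrix_mult_def vec_eq_iff algebra_simps sum_subtractf)

lemma matrix_add_rdistrib':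
  fixes A B :: "real^'b^'a" and C :: "real^'c^'b"
  shows "(A + B) ** C = A ** C + B ** C"
  by (simp add: matrix_matrix_mult_def vec_eq_iff algebra_simps sum.distrib)

lemma transpose_add: "transpose (A + B) = transpose A + transpose (B :: real^'b^'a)"
  by (simp add: transpose_def vec_eq_iff)

lemma transpose_diff: "transpose (A - B) = transpose A - transpose (B :: real^'b^'a)"
  by (simp add: transpose_def vec_eq_iff)

lemma matrix_minus_mult: "(- A) ** B = - (A ** (B :: real^'c^'b))" for A :: "real^'b^'a"
  by (simp add: matrix_matrix_mult_def vec_eq_iff sum_negf)

lemma matrix_mult_minus: "A ** (- B) = - (A ** (B :: real^'c^'b))" for A :: "real^'b^'a"
  by (simp add: matrix_matrix_mult_def vec_eq_iff sum_negf)

lemma minus_mult_vec: "(- A) *v x = - (A *v x)" for A :: "real^'b^'a"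
  by (simp add: matrix_vector_mult_def vec_eq_iff sum_negf)

lemma trace_transpose: "trace (transpose A) = trace (A :: real^'a^'a)"
  by (simp add: trace_def transpose_def)

lemma bounded_bilinear_transpose_mult:
  "bounded_bilinear (\<lambda>(A::real^'b^'a) (B::real^'c^'a). transpose A ** B)"
proof -
  have "bilinear (\<lambda>(A::real^'b^'a) (B::real^'c^'a). transpose A ** B)"
    unfolding bilinear_def
    by (intro conjI allI linearI)
      (simp_all add: transpose_add transpose_scalar matrix_add_rdistrib' matrix_add_ldistrib
        scalar_matrix_assoc matrix_scalar_ac)
  then show ?thesis by (simp add: bilinear_conv_bounded_bilinear)
qed

lemma tangent_layered_manifold:
  fixes Y :: "real^'p^'n"
  assumes "\<xi> \<in> tangent_vectors (layered_manifold Y) Y"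
  shows "transpose Y ** \<xi> + transpose \<xi> ** Y = 0"
proof -
  obtain \<gamma> where 0: "\<gamma> 0 = Y" and ev: "\<forall>\<^sub>F t in nhds 0. \<gamma> t \<in> layered_manifold Y"
    and d: "(\<gamma> has_vector_derivative \<xi>) (at 0)"
    using assms unfolding tangent_vectors_def by auto
  let ?f = "\<lambda>t. transpose (\<gamma> t) ** \<gamma> t"
  have A: "(?f has_vector_derivative (transpose (\<gamma> 0) ** \<xi> + transpose \<xi> ** \<gamma> 0)) (at 0)"
    by (rule bounded_bilinear.has_vector_derivative[OF bounded_bilinear_transpose_mult d d])
  have const: "((\<lambda>t. transpose Y ** Y) has_vector_derivative 0) (at (0::real))"
    by (rule has_vector_derivative_const)
  have "\<forall>\<^sub>F t in nhds 0. t \<in> UNIV \<longrightarrow> transpose Y ** Y = ?f t"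
    using ev by eventually_elim (simp add: layered_manifold_def)
  then have "(?f has_vector_derivative 0) (at 0)"
    by (rule has_vector_derivative_cong_ev[THEN iffD1, OF _ _ const]) (simp only: 0)
  then have "transpose (\<gamma> 0) ** \<xi> + transpose \<xi> ** \<gamma> 0 = 0"
    by (rule vector_derivative_unique_at[OF A])
  then show ?thesis by (simp only: 0)
qed

lemma plane_rotation_tangent:
  fixes Y :: "real^'p^'n" and U :: "real^'n^'n"
  assumes skew: "transpose U = - U" and cube: "U ** U ** U = - U"
  shows "U ** Y \<in> tangent_vectors (layered_manifold Y) Y"
proof -
  define \<gamma> where "\<gamma> t = Y + sin t *\<^sub>R (U ** Y) + (1 - cos t) *\<^sub>R (U ** U ** Y)" for t :: real
  define R where "R t = mat 1 + sin t *\<^sub>R U + (1 - cos t) *\<^sub>R (U ** U)" for t :: real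
  have \<gamma>R: "\<gamma> t = R t ** Y" for t
    by (simp add: \<gamma>_def R_def matrix_add_rdistrib' scalar_matrix_assoc)
  have quart: "U ** U ** (U ** U) = - (U ** U)"
    by (metis cube matrix_minus_mult matrix_mul_assoc)
  have cube': "U ** (U ** U) = - U"
    by (metis cube matrix_mul_assoc)
  have trR: "transpose (R t) = mat 1 - sin t *\<^sub>R U + (1 - cos t) *\<^sub>R (U ** U)" for t
  proof -
    have "transpose (U ** U) = U ** U"
      by (simp add: matrix_transpose_mul skew matrix_minus_mult matrix_mult_minus)
    then show ?thesis by (simp add: R_def transpose_add transpose_scalar skew)
  qed
  have orth: "transpose (R t) ** R t = mat 1" for t
  proof -
    let ?s = "sin t" and ?k = "1 - cos t"
    define V where "V = U ** U"
    have "U ** V = - U" "V ** U = - U" "V ** V = - V"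
      using cube cube' quart by (simp_all add: V_def)
    then have UR: "U ** R t = U + ?s *\<^sub>R V - ?k *\<^sub>R U"
      and VR: "V ** R t = V - ?s *\<^sub>R U - ?k *\<^sub>R V"
      unfolding R_def V_def[symmetric]
      by (simp_all only: matrix_add_ldistrib matrix_scalar_ac scalar_matrix_assoc[symmetric]
          matrix_mul_rid V_def[symmetric] scaleR_minus_right diff_conv_add_uminus)
    have "transpose (R t) ** R t = R t - ?s *\<^sub>R (U ** R t) + ?k *\<^sub>R (V ** R t)"
      unfolding trR V_def[symmetric]
      by (simp only: matrix_add_rdistrib' matrix_diff_distribs scalar_matrix_assoc[symmetric]
          matrix_mul_lid)
    also have "\<dots> = mat 1 + ?s *\<^sub>R U + ?k *\<^sub>R V
        - ?s *\<^sub>R (U + ?s *\<^sub>R V - ?k *\<^sub>R U) + ?k *\<^sub>R (V - ?s *\<^sub>R U - ?k *\<^sub>R V)"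
      by (simp only: UR VR) (simp only: R_def V_def)
    also have "\<dots> = mat 1 + (2 * ?k - ?s * ?s - ?k * ?k) *\<^sub>R V"
      by (simp only: vec_eq_iff vector_add_component vector_minus_component
          vector_scaleR_component real_scaleR_def) (intro allI, algebra)
    finally have "transpose (R t) ** R t = mat 1 + (2 * ?k - ?s * ?s - ?k * ?k) *\<^sub>R V" .
    moreover have "2 * ?k - ?s * ?s - ?k * ?k = 0"
      using sin_cos_squared_add[of t] by (simp add: power2_eq_square algebra_simps)
    ultimately show ?thesis by simp
  qed
  have "transpose (\<gamma> t) ** \<gamma> t = transpose Y ** Y" for t
    by (metis \<gamma>R matrix_mul_assoc matrix_mul_rid matrix_transpose_mul orth)
  then have "\<forall>t. \<gamma> t \<in> layered_manifold Y" by (simp add: layered_manifold_def)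
  moreover have "(\<gamma> has_vector_derivative U ** Y) (at 0)"
    unfolding \<gamma>_def by (auto intro!: derivative_eq_intros)
  moreover have "\<gamma> 0 = Y" by (simp add: \<gamma>_def)
  ultimately show ?thesis
    unfolding tangent_vectors_def by (auto intro!: exI[of _ \<gamma>])
qed

lemma symmetric_if_orthogonal_to_plane_rotations:
  fixes M :: "real^'n^'n"
  assumes "\<And>U::real^'n^'n. transpose U = - U \<Longrightarrow> U ** U ** U = - U \<Longrightarrow> trace (transpose U ** M) = 0"
  shows "transpose M = M"
proof -
  have "M $ i $ j = M $ j $ i" if ij: "i \<noteq> j" for i j
  proof -
    define U :: "real^'n^'n" where
      "U = (\<chi> a. if a = i then axis j 1 else if a = j then - axis i 1 else 0)"
    have Uv: "U *v x = (\<chi> a. if a = i then x $ j else if a = j then - (x $ i) else 0)" for x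
      by (simp add: U_def vec_eq_iff matrix_vector_mul_component inner_axis')
    have skew: "transpose U = - U"
      using ij by (simp add: U_def transpose_def vec_eq_iff axis_def)
    have "(U ** U ** U) *v x = (- U) *v x" for x
      using ij by (simp add: matrix_vector_mul_assoc[symmetric] minus_mult_vec Uv vec_eq_iff)
    then have cube: "U ** U ** U = - U" by (simp add: matrix_eq)
    have "trace (transpose U ** M) = (\<Sum>b\<in>UNIV. \<Sum>a\<in>UNIV. U $ a $ b * M $ a $ b)"
      by (simp add: trace_def matrix_matrix_mult_def transpose_def)
    also have "\<dots> = (\<Sum>a\<in>UNIV. U $ a \<bullet> M $ a)"
      by (subst sum.swap) (simp add: inner_vec_def)
    also have "\<dots> = (\<Sum>b\<in>UNIV. (if b = j then - M $ j $ i else if b = i then M $ i $ j else 0))"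
      using ij by (intro sum.cong refl) (simp add: U_def inner_axis')
    also have "\<dots> = M $ i $ j - M $ j $ i"
    proof -
      have "(if b = j then - M $ j $ i else if b = i then M $ i $ j else 0)
          = (if b = j then - M $ j $ i else 0) + (if b = i then M $ i $ j else 0)" for b
        using ij by simp
      then show ?thesis by (simp add: sum.distrib)
    qed
    finally show ?thesis using assms[OF skew cube] by simp
  qed
  then show ?thesis by (auto simp: transpose_def vec_eq_iff) metis
qed

theorem layered_normal_space_eq:
  fixes Y :: "real^'p^'n"
  assumes "rank Y = CARD('p)"
  shows "layered_normal_space Y =
     {Y ** matrix_inv (transpose Y ** Y) ** S | S. S = transpose S}"
proof -
  define H where "H = matrix_inv (transpose Y ** Y)"
  define P where "P = mat 1 - (1/2) *\<^sub>R (Y ** H ** transpose Y)"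
  have HG: "H ** (transpose Y ** Y) = mat 1" and GH: "transpose Y ** Y ** H = mat 1"
    and trH: "transpose H = H"
    using gram_inverse[OF assms] by (simp_all add: H_def)
  have g: "layered_metric Y \<xi> \<eta> = trace (transpose \<xi> ** P ** \<eta> ** H)" for \<xi> \<eta>
    by (simp add: layered_metric_def H_def P_def)
  have PY: "P ** Y = (1/2) *\<^sub>R Y"
  proof -
    have "Y ** H ** transpose Y ** Y = Y"
      by (metis HG matrix_mul_assoc matrix_mul_rid)
    then have "P ** Y = Y - (1/2) *\<^sub>R Y"
      by (simp add: P_def matrix_diff_distribs scalar_matrix_assoc[symmetric])
    also have "\<dots> = (1/2) *\<^sub>R Y" by (simp add: vec_eq_iff)
    finally show ?thesis .
  qed
  have trP: "transpose P = P"
    by (simp add: P_def transpose_diff transpose_scalar matrix_transpose_mul trH matrix_mul_assoc)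
  have "\<eta> \<in> layered_normal_space Y" if S: "S = transpose S" and \<eta>: "\<eta> = Y ** H ** S" for S \<eta>
  proof -
    have "layered_metric Y \<xi> \<eta> = 0" if "\<xi> \<in> tangent_vectors (layered_manifold Y) Y" for \<xi>
    proof -
      define K where "K = H ** S ** H"
      have trK: "transpose K = K"
        using S trH by (simp add: K_def matrix_transpose_mul matrix_mul_assoc)
      have "transpose \<xi> ** P ** \<eta> ** H = transpose \<xi> ** (P ** Y) ** K"
        by (simp add: \<eta> K_def matrix_mul_assoc)
      also have "\<dots> = (1/2) *\<^sub>R (transpose \<xi> ** Y ** K)"
        by (simp add: PY matrix_scalar_ac scalar_matrix_assoc[symmetric])
      finally have 1: "layered_metric Y \<xi> \<eta> = (1/2) * trace (transpose \<xi> ** Y ** K)"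
        by (simp add: g trace_def sum_distrib_left)
      have "trace (transpose \<xi> ** Y ** K) = trace (transpose (transpose \<xi> ** Y ** K))"
        by (simp add: trace_transpose)
      also have "\<dots> = trace (K ** (transpose Y ** \<xi>))"
        by (simp add: matrix_transpose_mul trK)
      also have "\<dots> = trace (transpose Y ** \<xi> ** K)" by (rule trace_mul_sym)
      finally have "2 * trace (transpose \<xi> ** Y ** K)
          = trace ((transpose Y ** \<xi> + transpose \<xi> ** Y) ** K)"
        by (simp add: matrix_add_rdistrib' trace_add)
      then show ?thesis
        using 1 tangent_layered_manifold[OF that] by (simp add: trace_def)
    qed
    then show ?thesis by (simp add: layered_normal_space_def normal_vectors_def)
  qed
  moreover have "\<exists>S. \<eta> = Y ** H ** S \<and> S = transpose S" if \<eta>: "\<eta> \<in> layered_normal_space Y" for \<eta>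
  proof -
    define M where "M = P ** \<eta> ** H ** transpose Y"
    have "trace (transpose U ** M) = 0" if "transpose U = - U" "U ** U ** U = - U" for U
    proof -
      have "0 = layered_metric Y (U ** Y) \<eta>"
        using \<eta> plane_rotation_tangent[OF that, of Y]
        by (simp add: layered_normal_space_def normal_vectors_def)
      also have "\<dots> = trace (transpose Y ** (transpose U ** P ** \<eta> ** H))"
        by (simp add: g matrix_transpose_mul matrix_mul_assoc)
      also have "\<dots> = trace (transpose U ** M)"
        by (subst trace_mul_sym) (simp add: M_def matrix_mul_assoc)
      finally show ?thesis by simp
    qed
    then have sym: "transpose M = M"
      by (rule symmetric_if_orthogonal_to_plane_rotations)
    have "P ** \<eta> = M ** Y"
    proof -
      have "M ** Y = P ** \<eta> ** (H ** (transpose Y ** Y))"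
        by (simp only: M_def matrix_mul_assoc)
      then show ?thesis by (simp only: HG matrix_mul_rid)
    qed
    also have "\<dots> = transpose M ** Y" by (simp add: sym)
    also have "\<dots> = Y ** H ** transpose \<eta> ** (P ** Y)"
      by (simp add: M_def matrix_transpose_mul trP trH matrix_mul_assoc)
    also have "\<dots> = (1/2) *\<^sub>R (Y ** H ** (transpose \<eta> ** Y))"
      by (simp only: PY matrix_scalar_ac scalar_matrix_assoc[symmetric] matrix_mul_assoc)
    finally have "\<eta> - (1/2) *\<^sub>R (Y ** H ** (transpose Y ** \<eta>))
        = (1/2) *\<^sub>R (Y ** H ** (transpose \<eta> ** Y))"
      by (simp add: P_def matrix_diff_distribs scalar_matrix_assoc[symmetric] matrix_mul_assoc)
    then have "\<eta> = Y ** H ** ((1/2) *\<^sub>R (transpose \<eta> ** Y + transpose Y ** \<eta>))"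
      by (simp add: matrix_scalar_ac scalar_matrix_assoc[symmetric] matrix_add_ldistrib
          scaleR_add_right diff_eq_eq)
    moreover have "(1/2) *\<^sub>R (transpose \<eta> ** Y + transpose Y ** \<eta>)
        = transpose ((1/2) *\<^sub>R (transpose \<eta> ** Y + transpose Y ** \<eta>))"
      by (simp add: transpose_scalar transpose_add matrix_transpose_mul add.commute)
    ultimately show ?thesis by blast
  qed
  ultimately show ?thesis unfolding H_def[symmetric] by blast
qed

end

theory Submission
  imports Defs
begin

text \<open>Write \<open>G = Y\<^sup>T Y\<close>, which is invertible because \<open>Y\<close> has full column rank, and let
  \<open>Q = q\<^sub>r(G - I) - I\<close>. Inserting \<open>G\<^sup>-\<^sup>1 G\<close> turns the update \<open>Y Q\<close> into \<open>Y G\<^sup>-\<^sup>1 (G Q)\<close>, which is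
  a normal vector by \<open>layered_normal_space_eq\<close> as soon as \<open>G Q\<close> is symmetric. Now \<open>Q\<close> is a real
  polynomial in the symmetric matrix \<open>G\<close>, hence symmetric (\<open>transpose_newton_schulz_poly\<close>) and
  commuting with \<open>G\<close> (\<open>newton_schulz_poly_commute\<close>), and a product of two commuting symmetric
  matrices is symmetric.\<close>

lemma matrix_power_commute:
  fixes A B :: "real^'p^'p"
  assumes "A ** B = B ** A"
  shows "A ** matrix_power B k = matrix_power B k ** A"
proof (induction k)
  case (Suc k)
  then show ?case
    by (metis assms matrix_mul_assoc matrix_power.simps(2))
qed simp

lemma newton_schulz_poly_Suc:
  "newton_schulz_poly (Suc r) S = newton_schulz_poly r S +
     ((-1) ^ Suc r * (fact (2 * Suc r) / (fact (Suc r))\<^sup>2) / 4 ^ Suc r) *\<^sub>R matrix_power S (Suc r)"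
  unfolding newton_schulz_poly_def by (rule sum.atLeast0_atMost_Suc)

lemma newton_schulz_poly_commute:
  fixes A B :: "real^'p^'p"
  assumes "A ** B = B ** A"
  shows "A ** newton_schulz_poly r B = newton_schulz_poly r B ** A"
proof (induction r)
  case 0
  show ?case by (simp add: newton_schulz_poly_def)
next
  case (Suc r)
  then show ?case
    by (simp only: newton_schulz_poly_Suc matrix_add_ldistrib matrix_add_rdistrib'
        matrix_scalar_ac scalar_matrix_assoc[symmetric] matrix_power_commute[OF assms])
qed

lemma transpose_matrix_power:
  fixes A :: "real^'p^'p"
  shows "transpose (matrix_power A k) = matrix_power (transpose A) k"
proof (induction k)
  case (Suc k)
  \<comment> \<open>Transposition puts the new factor on the left, whereas powers grow on the right.\<close>
  then show ?case
    by (simp add: matrix_transpose_mul matrix_power_commute)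
qed simp

lemma transpose_newton_schulz_poly:
  fixes A :: "real^'p^'p"
  shows "transpose (newton_schulz_poly r A) = newton_schulz_poly r (transpose A)"
proof (induction r)
  case 0
  show ?case by (simp add: newton_schulz_poly_def)
next
  case (Suc r)
  then show ?case
    by (simp only: newton_schulz_poly_Suc transpose_add transpose_scalar transpose_matrix_power)
qed

theorem proposition3p1:
  fixes r :: nat and Y :: "real^'p^'n"
  assumes "r \<ge> 1"
    and "rank Y = CARD('p)"
  shows "newton_schulz_update r Y \<in> layered_normal_space Y"
proof -
  define G where "G = transpose Y ** Y"
  define Q where "Q = newton_schulz_poly r (G - mat 1) - mat 1"
  have trG: "transpose G = G"
    by (simp add: G_def matrix_transpose_mul)
  have trQ: "transpose Q = Q"
    by (simp add: Q_def transpose_diff transpose_newton_schulz_poly trG)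
  have "G ** (G - mat 1) = (G - mat 1) ** G"
    by (simp add: matrix_diff_distribs)
  then have comm: "G ** Q = Q ** G"
    by (simp add: Q_def matrix_diff_distribs newton_schulz_poly_commute)
  have "newton_schulz_update r Y = Y ** (matrix_inv G ** G) ** Q"
    using gram_inverse(2)[OF assms(2)] by (simp add: newton_schulz_update_def Q_def G_def)
  also have "\<dots> = Y ** matrix_inv G ** (G ** Q)"
    by (simp only: matrix_mul_assoc)
  finally have "newton_schulz_update r Y = Y ** matrix_inv G ** (G ** Q)" .
  moreover have "G ** Q = transpose (G ** Q)"
    by (simp add: matrix_transpose_mul trG trQ comm)
  ultimately show ?thesis
    unfolding layered_normal_space_eq[OF assms(2)] G_def by blast
qed

end
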